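(* Let $G$ be a connected graph on $n$ vertices. If $G \neq K_{1,n-1}$ and $G$ has a vertex of degree at least $3$, then $G$ is freely solvable in reversible peg solitaire. Furthermore, $G$ is doubly freely solvable if and only if there is a path joining two vertices of degree at least $3$ whose length is not divisible by $3$.
   Context: Graphs are finite and simple. Reversible peg solitaire on $G$: a configuration assigns to each vertex either a peg or a hole. If $xyz$ is a path in $G$ ($x$ adjacent to $y$, $y$ adjacent to $z$, $x,y,z$ distinct), a jump is allowed when $x$ and $y$ have pegs and $z$ has a hole: it removes the pegs from $x$ and $y$ and places a peg on $z$. An unjump is the reverse move: when $x$ and $y$ have holes and $z$ has a peg, it removes the peg from $z$ and places pegs on $x$ and $y$. $G$ is solvable if for some starting configuration with exactly one hole, some finite sequence of jumps and unjumps produces a configuration with exactly one peg. $G$ is freely solvable if this is possible from every starting configuration with exactly one hole. $G$ is doubly freely solvable if for every starting configuration with exactly one hole and every vertex $v$ of $G$, some finite sequence of jumps and unjumps produces the configuration with a single peg located on $v$. $K_{1,n-1}$ denotes the star on $n$ vertices; the length of a path is its number of edges.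
   Formalization: The path may also be closed, i.e. a cycle through one vertex of degree at least 3; with ordinary paths only, the equivalence fails for the 4-cycle with a pendant vertex, which is doubly freely solvable but has just one vertex of degree at least 3. *)

theory Defs
  imports "Graph_Theory.Graph_Theory"
begin

text \<open>
  Finite simple graphs are the locale \<^locale>\<open>pair_graph\<close>: finite, loop-free, symmetric sets of
  ordered pairs.  Each undirected edge occurs as two opposite arcs, so the degree of a vertex is
  its out-degree.
\<close>

abbreviation degree :: "'a pair_pre_digraph \<Rightarrow> 'a \<Rightarrow> nat" where
  "degree G v \<equiv> out_degree (with_proj G) v"

text \<open>
  A path joining \<open>u\<close> and \<open>v\<close>, given by its list of vertices.  The two ends may coincide: besides
  ordinary paths, a path that closes up into a cycle through \<open>u = v\<close> is admitted.  The bound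
  \<open>3 \<le> vwalk_length p\<close> is the usual one for cycles of a simple graph; it excludes walking along
  an edge and back.  Closed paths matter for double free solvability: the 4-cycle with one pendant
  vertex is doubly freely solvable, and it has only one vertex of degree at least 3, which lies on
  a closed path of length 4.
\<close>

definition path_joining :: "'a pair_pre_digraph \<Rightarrow> 'a \<Rightarrow> 'a vwalk \<Rightarrow> 'a \<Rightarrow> bool" where
  "path_joining G u p v \<longleftrightarrow>
     hd p = u \<and> last p = v \<and>
     (vpath p (with_proj G) \<or>
      vwalk p (with_proj G) \<and> u = v \<and> distinct (tl p) \<and> 3 \<le> vwalk_length p)"

text \<open>
  A configuration on \<open>G\<close> is represented by its set of pegs, a subset of \<open>pverts G\<close>.
\<close>

definition jump :: "'a pair_pre_digraph \<Rightarrow> 'a set \<Rightarrow> 'a set \<Rightarrow> bool" where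
  "jump G P Q \<longleftrightarrow>
     (\<exists>x y z. vpath [x, y, z] (with_proj G) \<and> x \<in> P \<and> y \<in> P \<and> z \<notin> P \<and>
              Q = insert z (P - {x, y}))"

definition unjump :: "'a pair_pre_digraph \<Rightarrow> 'a set \<Rightarrow> 'a set \<Rightarrow> bool" where
  "unjump G P Q \<longleftrightarrow>
     (\<exists>x y z. vpath [x, y, z] (with_proj G) \<and> x \<notin> P \<and> y \<notin> P \<and> z \<in> P \<and>
              Q = P - {z} \<union> {x, y})"

definition produces :: "'a pair_pre_digraph \<Rightarrow> 'a set \<Rightarrow> 'a set \<Rightarrow> bool" where
  "produces G = (\<lambda>P Q. jump G P Q \<or> unjump G P Q)\<^sup>*\<^sup>*"

definition freely_solvable :: "'a pair_pre_digraph \<Rightarrow> bool" where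
  "freely_solvable G \<longleftrightarrow>
     (\<forall>h \<in> pverts G. \<exists>v \<in> pverts G. produces G (pverts G - {h}) {v})"

definition doubly_freely_solvable :: "'a pair_pre_digraph \<Rightarrow> bool" where
  "doubly_freely_solvable G \<longleftrightarrow>
     (\<forall>h \<in> pverts G. \<forall>v \<in> pverts G. produces G (pverts G - {h}) {v})"

end

theory Submission
  imports Defs
begin

text \<open>
  A jump or unjump along a path \<open>xyz\<close> is one and the same operation: if exactly one of the ends
  \<open>x\<close>, \<open>z\<close> carries a peg, flip all three vertices.  Hence a set \<open>L\<close> of vertices that meets every
  such path in an even number of vertices gives an invariant, the parity of the number of pegs
  in \<open>L\<close>.

  Fix a vertex \<open>u\<close> of degree at least 3 and three of its neighbours.  As long as these three do
  not all look alike, the moves at \<open>u\<close> permute their contents freely and toggle \<open>u\<close> at will.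
  Adding the remaining vertices one at a time, this shows that such configurations are
  classified by at most one parity, the one for a set \<open>L\<close> that contains the neighbours of \<open>u\<close>
  but not \<open>u\<close>.  Both parities occur among single pegs, so the graph is freely solvable, and it
  is doubly freely solvable unless that parity is invariant.

  If it is invariant, \<open>L\<close> follows the pattern 0, 1, 1, 0, 1, 1, \<dots> along any path from \<open>u\<close> and
  avoids all vertices of degree at least 3, so the path can end at such a vertex only after a
  multiple of 3 steps.  Conversely, if all the relevant paths have length divisible by 3, the
  vertices at distance not divisible by 3 from \<open>u\<close> form an invariant \<open>L\<close>: a violation would
  come from an edge closing a cycle with two shortest paths from \<open>u\<close>, and the vertex where
  these two separate has degree at least 3.
\<close>

section \<open>Parities\<close>

text \<open>Symmetric difference, phrased so that membership unfolds to a Boolean inequality and the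
  effect of several moves can be checked pointwise.\<close>

definition flip :: "'a set \<Rightarrow> 'a set \<Rightarrow> 'a set" where
  "flip T P = {x. (x \<in> P) \<noteq> (x \<in> T)}"

lemma in_flip [simp]: "x \<in> flip T P \<longleftrightarrow> (x \<in> P) \<noteq> (x \<in> T)"
  by (simp add: flip_def)

definition par :: "'a set \<Rightarrow> 'a set \<Rightarrow> bool" where
  "par L Q \<longleftrightarrow> odd (card (Q \<inter> L))"

lemma par_empty [simp]: "\<not> par L {}"
  by (simp add: par_def)

lemma par_insert [simp]:
  assumes "finite Q" "x \<notin> Q"
  shows "par L (insert x Q) \<longleftrightarrow> (x \<in> L) \<noteq> par L Q"
  using assms by (simp add: par_def Int_insert_left)

lemma par_flip:
  assumes "finite T" "finite P"
  shows "par L (flip T P) \<longleftrightarrow> par L P \<noteq> par L T"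
  using assms(1)
proof (induction T)
  case empty
  show ?case by (simp add: flip_def)
next
  case (insert x T)
  have fin: "finite (flip T P)"
    by (rule finite_subset[of _ "T \<union> P"]) (auto simp: insert assms)
  show ?case
  proof (cases "x \<in> P")
    case True
    then have "flip T P = insert x (flip (insert x T) P)"
      using insert by auto
    moreover have "finite (flip (insert x T) P)"
      by (rule finite_subset[of _ "insert x T \<union> P"]) (auto simp: insert assms)
    ultimately have "par L (flip T P) \<longleftrightarrow> (x \<in> L) \<noteq> par L (flip (insert x T) P)"
      using True by simp
    then show ?thesis using insert by auto
  next
    case False
    then have "flip (insert x T) P = insert x (flip T P)"
      using insert by auto
    then show ?thesis using insert False fin by auto
  qed
qed

lemma par_eq_iff_flip:
  assumes "finite P" "finite Q"
  shows "par L P = par L Q \<longleftrightarrow> \<not> par L (flip P Q)"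
  using par_flip[OF assms] by auto

text \<open>The difference \<open>flip P Q\<close> lies inside \<open>S\<close>, where
  \<open>L\<close> and \<open>L'\<close> agree. This permits comparing parities after
  \<open>L\<close> has gained a vertex outside \<open>S\<close>.\<close>

lemma par_eq_cong:
  assumes "finite P" "finite Q" "P - S = Q - S" "L \<inter> S = L' \<inter> S"
  shows "par L P = par L Q \<longleftrightarrow> par L' P = par L' Q"
proof -
  have "flip P Q \<inter> L = flip P Q \<inter> L'"
    using assms(3,4) by (auto simp: set_eq_iff)
  then have "par L (flip P Q) = par L' (flip P Q)"
    by (simp add: par_def)
  then show ?thesis
    using par_eq_iff_flip assms(1,2) by metis
qed

text \<open>When \<open>A\<close> consists of neighbours of \<open>u\<close>, this says exactly that
  some move with middle vertex \<open>u\<close> between two members of \<open>A\<close> is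
  available.\<close>

definition live :: "'a set \<Rightarrow> 'a set \<Rightarrow> bool" where
  "live A Q \<longleftrightarrow> A \<inter> Q \<noteq> {} \<and> \<not> A \<subseteq> Q"

lemma liveI: "j \<in> A \<Longrightarrow> k \<in> A \<Longrightarrow> j \<in> Q \<Longrightarrow> k \<notin> Q \<Longrightarrow> live A Q"
  by (auto simp: live_def)

text \<open>The letters are the contents of three leaves before and after. An even, nonzero number
  of changes means two; if those two leaves were alike, all three would be alike before or after. So
  two unlike leaves are exchanged.\<close>

lemma bool_swap_cases: "(p::bool) \<noteq> p' \<longleftrightarrow> (q \<noteq> q') \<noteq> (r \<noteq> r') \<Longrightarrow> p \<or> q \<or> r \<Longrightarrow> \<not> p \<or> \<not> q \<or> \<not> r \<Longrightarrow>
  p' \<or> q' \<or> r' \<Longrightarrow> \<not> p' \<or> \<not> q' \<or> \<not> r' \<Longrightarrow> p \<noteq> p' \<or> q \<noteq> q' \<or> r \<noteq> r' \<Longrightarrow>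
  (p \<and> \<not> q \<and> \<not> p' \<and> q' \<and> r = r') \<or> (q \<and> \<not> p \<and> \<not> q' \<and> p' \<and> r = r') \<or>
  (p \<and> \<not> r \<and> \<not> p' \<and> r' \<and> q = q') \<or> (r \<and> \<not> p \<and> \<not> r' \<and> p' \<and> q = q') \<or>
  (q \<and> \<not> r \<and> \<not> q' \<and> r' \<and> p = p') \<or> (r \<and> \<not> q \<and> \<not> r' \<and> q' \<and> p = p')"
  by (cases p; cases q; cases r; cases p'; cases q'; cases r'; simp)

section \<open>Moves and the star at a branch vertex\<close>

locale solitaire =
  fixes V :: "'a set" and adj :: "'a \<Rightarrow> 'a \<Rightarrow> bool"
  assumes finite_V: "finite V"
    and adj_sym: "adj x y \<Longrightarrow> adj y x"
    and adj_irrefl: "\<not> adj x x"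
    and adj_V: "adj x y \<Longrightarrow> x \<in> V"
    and connected_V: "x \<in> V \<Longrightarrow> y \<in> V \<Longrightarrow> adj\<^sup>*\<^sup>* x y"
begin

lemma adj_V2: "adj x y \<Longrightarrow> y \<in> V"
  using adj_sym adj_V by blast

text \<open>A peg on \<open>y\<close> makes this a jump, a hole on \<open>y\<close> an unjump of the
  peg on \<open>x\<close>. The three vertices are automatically distinct: \<open>x\<close> and
  \<open>z\<close> differ in content, and adjacency is irreflexive.\<close>

definition move :: "'a set \<Rightarrow> 'a set \<Rightarrow> bool" where
  "move P Q \<longleftrightarrow> (\<exists>x y z. adj x y \<and> adj y z \<and> x \<in> P \<and> z \<notin> P \<and> Q = flip {x, y, z} P)"

definition eqv :: "'a set \<Rightarrow> 'a set \<Rightarrow> bool" where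
  "eqv = move\<^sup>*\<^sup>*"

lemma moveI: "adj x y \<Longrightarrow> adj y z \<Longrightarrow> x \<in> P \<Longrightarrow> z \<notin> P \<Longrightarrow> move P (flip {x, y, z} P)"
  by (auto simp: move_def)

lemma move_sym: "move P Q \<Longrightarrow> move Q P"
proof -
  assume "move P Q"
  then obtain x y z where *: "adj x y" "adj y z" "x \<in> P" "z \<notin> P" "Q = flip {x, y, z} P"
    by (auto simp: move_def)
  have "adj z y" "adj y x" using * adj_sym by auto
  moreover have "P = flip {z, y, x} Q" using * by auto
  moreover have "z \<in> Q" "x \<notin> Q" using * by auto
  ultimately show ?thesis unfolding move_def by blast
qed

lemma eqv_refl [simp]: "eqv P P"
  by (simp add: eqv_def)

lemma eqv_trans [trans]: "eqv P Q \<Longrightarrow> eqv Q R \<Longrightarrow> eqv P R"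
  unfolding eqv_def by (rule rtranclp_trans)

lemma eqv_sym: "eqv P Q \<Longrightarrow> eqv Q P"
  unfolding eqv_def using move_sym by (metis sympD sympI symp_rtranclp)

lemma eqv_move: "move P Q \<Longrightarrow> eqv P Q"
  by (simp add: eqv_def r_into_rtranclp)

lemma eqv_flip:
  assumes "adj x y" "adj y z" "x \<in> P" "z \<notin> P" "Q = flip {x, y, z} P"
  shows "eqv P Q"
  using moveI[OF assms(1-4)] eqv_move assms(5) by blast

lemma move_subset: "move P Q \<Longrightarrow> P \<subseteq> V \<Longrightarrow> Q \<subseteq> V"
  using adj_V adj_V2 by (auto simp: move_def)

lemma eqv_subset: "eqv P Q \<Longrightarrow> P \<subseteq> V \<Longrightarrow> Q \<subseteq> V"
  unfolding eqv_def by (induction rule: rtranclp_induct) (auto dest: move_subset)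

text \<open>Exchanging pegs and holes reverses the path \<open>x y z\<close>. This duality reduces
  positions with one hole to single pegs.\<close>

lemma move_compl:
  assumes "move P Q" "P \<subseteq> V"
  shows "move (V - P) (V - Q)"
proof -
  obtain x y z where *: "adj x y" "adj y z" "x \<in> P" "z \<notin> P" "Q = flip {x, y, z} P"
    using assms by (auto simp: move_def)
  have V: "x \<in> V" "y \<in> V" "z \<in> V" using * adj_V adj_V2 by auto
  have "V - Q = flip {z, y, x} (V - P)" using * V by auto
  then show ?thesis
    using * V adj_sym unfolding move_def by (metis Diff_iff)
qed

lemma eqv_compl:
  assumes "eqv P Q" "P \<subseteq> V"
  shows "eqv (V - P) (V - Q)"
  using assms(1) unfolding eqv_def
proof (induction rule: rtranclp_induct)
  case (step Q R)
  then have "Q \<subseteq> V" using eqv_subset assms(2) by (simp add: eqv_def)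
  then show ?case using step move_compl by (meson rtranclp.rtrancl_into_rtrancl)
qed simp

text \<open>Three moves through \<open>u\<close>, one for each pair of leaves, flip every leaf twice
  and \<open>u\<close> three times. The content of the third leaf \<open>k\<close> decides an order
  in which each move has unlike ends.\<close>

lemma toggle_centre:
  assumes adj: "adj u a" "adj u b" "adj u c"
    and distinct: "a \<noteq> b" "b \<noteq> c" "a \<noteq> c"
    and "live {a, b, c} Q"
  shows "eqv Q (flip {u} Q)"
proof -
  have adj': "adj a u" "adj b u" "adj c u" using adj adj_sym by auto
  have key: "eqv Q (flip {u} Q)"
    if t: "{i, j, k} = {a, b, c}" "i \<noteq> j" "j \<noteq> k" "i \<noteq> k" "i \<in> Q" "j \<notin> Q" for i j k
  proof -
    have ad: "adj u i" "adj u j" "adj u k" "adj i u" "adj j u" "adj k u"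
      using t(1) adj adj' by (metis insertCI insertE singletonD)+
    have ne: "i \<noteq> u" "j \<noteq> u" "k \<noteq> u" using ad adj_irrefl by auto
    show ?thesis
    proof (cases "k \<in> Q")
      case False
      define Q1 where "Q1 = flip {i, u, j} Q"
      define Q2 where "Q2 = flip {j, u, k} Q1"
      have "eqv Q Q1" by (rule eqv_flip[of i u j]) (use ad t Q1_def in auto)
      also have "eqv Q1 Q2"
        by (rule eqv_flip[of j u k]) (use ad t ne False Q1_def Q2_def in auto)
      also have "eqv Q2 (flip {u} Q)"
        by (rule eqv_flip[of k u i]) (use ad t ne False Q1_def Q2_def in auto)
      finally show ?thesis .
    next
      case True
      define Q1 where "Q1 = flip {i, u, j} Q"
      define Q2 where "Q2 = flip {k, u, i} Q1"
      have "eqv Q Q1" by (rule eqv_flip[of i u j]) (use ad t Q1_def in auto)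
      also have "eqv Q1 Q2"
        by (rule eqv_flip[of k u i]) (use ad t ne True Q1_def Q2_def in auto)
      also have "eqv Q2 (flip {u} Q)"
        by (rule eqv_flip[of j u k]) (use ad t ne True Q1_def Q2_def in auto)
      finally show ?thesis .
    qed
  qed
  obtain i j where ij: "i \<in> {a, b, c}" "j \<in> {a, b, c}" "i \<in> Q" "j \<notin> Q"
    using assms(7) by (auto simp: live_def)
  then obtain k where "{i, j, k} = {a, b, c}" "j \<noteq> k" "i \<noteq> k" "i \<noteq> j"
    using distinct by auto
  then show ?thesis using key ij by blast
qed

text \<open>
  Inside \<open>S\<close>, the parity with respect to \<open>L\<close> is the only obstruction between configurations for
  which the vertices of \<open>A\<close> do not all look alike; outside \<open>S\<close> nothing is moved.
\<close>

definition controlled :: "'a set \<Rightarrow> 'a set \<Rightarrow> 'a set \<Rightarrow> bool" where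
  "controlled A S L \<longleftrightarrow> L \<subseteq> S \<and>
     (\<forall>Q Q'. Q \<subseteq> V \<longrightarrow> Q' \<subseteq> V \<longrightarrow> live A Q \<longrightarrow> live A Q' \<longrightarrow> Q - S = Q' - S \<longrightarrow>
        par L Q = par L Q' \<longrightarrow> eqv Q Q')"

text \<open>Two live leaf patterns of equal parity coincide or differ by exchanging two unlike
  leaves, which one move through \<open>u\<close> does. The content of \<open>u\<close> is then
  corrected by \<open>toggle_centre\<close>.\<close>

lemma controlled_star:
  assumes adj: "adj u a" "adj u b" "adj u c"
    and distinct: "a \<noteq> b" "b \<noteq> c" "a \<noteq> c"
  shows "controlled {a, b, c} {u, a, b, c} {a, b, c}"
  unfolding controlled_def
proof (intro conjI allI impI)
  fix Q Q'
  assume sub: "Q \<subseteq> V" "Q' \<subseteq> V" and lv: "live {a, b, c} Q" "live {a, b, c} Q'"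
    and diff: "Q - {u, a, b, c} = Q' - {u, a, b, c}"
    and par: "par {a, b, c} Q = par {a, b, c} Q'"
  have off: "x \<in> Q \<longleftrightarrow> x \<in> Q'" if "x \<notin> {u, a, b, c}" for x
    using diff that by blast
  have adj': "adj a u" "adj b u" "adj c u" using adj adj_sym by auto
  have ne: "a \<noteq> u" "b \<noteq> u" "c \<noteq> u" using adj adj_irrefl by auto
  have fin: "finite Q" "finite Q'" using sub finite_V finite_subset by auto
  have toggle: "eqv P (flip {u} P)" if "live {a, b, c} P" for P
    using toggle_centre adj distinct that by blast
  have flipD: "\<not> par {a, b, c} (flip Q Q')" using par par_eq_iff_flip fin by blast
  have "flip Q Q' \<inter> {a, b, c} = {x \<in> {a, b, c}. (x \<in> Q) \<noteq> (x \<in> Q')}" by auto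
  then have ev: "even (card {x \<in> {a, b, c}. (x \<in> Q) \<noteq> (x \<in> Q')})"
    using flipD by (simp add: par_def)
  have ev3: "even (of_bool ((a \<in> Q) \<noteq> (a \<in> Q')) + of_bool ((b \<in> Q) \<noteq> (b \<in> Q'))
      + of_bool ((c \<in> Q) \<noteq> (c \<in> Q')) :: nat)"
  proof -
    have "card {x \<in> {a, b, c}. (x \<in> Q) \<noteq> (x \<in> Q')}
      = (\<Sum>x\<in>{a, b, c}. of_bool ((x \<in> Q) \<noteq> (x \<in> Q')))"
      by (simp add: Int_def)
    then show ?thesis using ev distinct by (simp add: add.assoc del: sum_of_bool_eq)
  qed
  have fin_case: "eqv P Q'" if "live {a, b, c} P" "\<forall>x. x \<noteq> u \<longrightarrow> (x \<in> P \<longleftrightarrow> x \<in> Q')" for P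
  proof (cases "u \<in> P \<longleftrightarrow> u \<in> Q'")
    case True
    then have "P = Q'" using that by (auto simp: set_eq_iff)
    then show ?thesis by simp
  next
    case False
    then have "flip {u} P = Q'" using that by (auto simp: set_eq_iff)
    then show ?thesis using toggle that by metis
  qed
  have swap: "eqv Q Q'"
    if t: "{i, j, k} = {a, b, c}" "i \<noteq> j" "j \<noteq> k" "i \<noteq> k"
        "i \<in> Q \<and> j \<notin> Q \<and> i \<notin> Q' \<and> j \<in> Q' \<and> (k \<in> Q \<longleftrightarrow> k \<in> Q')" for i j k
  proof -
    have ad: "adj u j" "adj i u" "i \<noteq> u" "j \<noteq> u"
      using t(1) adj adj' ne by (metis insertCI insertE singletonD)+
    have "eqv Q (flip {i, u, j} Q)"
      by (rule eqv_flip[of i u j]) (use ad t in auto)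
    also have "eqv (flip {i, u, j} Q) Q'"
    proof (rule fin_case)
      have "i \<in> {a, b, c}" "j \<in> {a, b, c}" using t(1) by blast+
      then show "live {a, b, c} (flip {i, u, j} Q)"
        by (intro liveI[of j _ i]) (use t ad in auto)
      show "\<forall>x. x \<noteq> u \<longrightarrow> (x \<in> flip {i, u, j} Q \<longleftrightarrow> x \<in> Q')"
      proof (intro allI impI)
        fix x assume "x \<noteq> u"
        then consider "x = i" | "x = j" | "x = k" "x \<notin> {i, j}" | "x \<notin> {u, a, b, c}" "x \<notin> {i, j}"
          using t by blast
        then show "x \<in> flip {i, u, j} Q \<longleftrightarrow> x \<in> Q'"
          by cases (use t off \<open>x \<noteq> u\<close> in auto)
      qed
    qed
    finally show ?thesis .
  qed
  have same: "eqv Q Q'" if "\<forall>x\<in>{a, b, c}. x \<in> Q \<longleftrightarrow> x \<in> Q'"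
    using fin_case[of Q] that lv(1) off by blast
  have ev_bool: "(a \<in> Q) \<noteq> (a \<in> Q') \<longleftrightarrow> ((b \<in> Q) \<noteq> (b \<in> Q')) \<noteq> ((c \<in> Q) \<noteq> (c \<in> Q'))"
    using ev3
    by (cases "(a \<in> Q) \<noteq> (a \<in> Q')"; cases "(b \<in> Q) \<noteq> (b \<in> Q')"; cases "(c \<in> Q) \<noteq> (c \<in> Q')"; simp)
  have lv_bool: "a \<in> Q \<or> b \<in> Q \<or> c \<in> Q" "a \<notin> Q \<or> b \<notin> Q \<or> c \<notin> Q"
    "a \<in> Q' \<or> b \<in> Q' \<or> c \<in> Q'" "a \<notin> Q' \<or> b \<notin> Q' \<or> c \<notin> Q'"
    using lv by (auto simp: live_def)
  show "eqv Q Q'"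
  proof (cases "\<forall>x\<in>{a, b, c}. x \<in> Q \<longleftrightarrow> x \<in> Q'")
    case True
    then show ?thesis by (rule same)
  next
    case False
    then have neq: "(a \<in> Q) \<noteq> (a \<in> Q') \<or> (b \<in> Q) \<noteq> (b \<in> Q') \<or> (c \<in> Q) \<noteq> (c \<in> Q')"
      by simp
    let ?T = "\<lambda>i j k. i \<in> Q \<and> j \<notin> Q \<and> i \<notin> Q' \<and> j \<in> Q' \<and> (k \<in> Q \<longleftrightarrow> k \<in> Q')"
    have "?T a b c \<or> ?T b a c \<or> ?T a c b \<or> ?T c a b \<or> ?T b c a \<or> ?T c b a"
      by (rule bool_swap_cases[OF ev_bool lv_bool neq])
    then show ?thesis
    proof (elim disjE)
      assume "?T a b c"
      then show ?thesis by (intro swap[of a b c]) (use distinct in auto)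
    next
      assume "?T b a c"
      then show ?thesis by (intro swap[of b a c]) (use distinct in auto)
    next
      assume "?T a c b"
      then show ?thesis by (intro swap[of a c b]) (use distinct in auto)
    next
      assume "?T c a b"
      then show ?thesis by (intro swap[of c a b]) (use distinct in auto)
    next
      assume "?T b c a"
      then show ?thesis by (intro swap[of b c a]) (use distinct in auto)
    next
      assume "?T c b a"
      then show ?thesis by (intro swap[of c b a]) (use distinct in auto)
    qed
  qed
qed auto

section \<open>Growing the controlled set one vertex at a time\<close>

text \<open>The move along \<open>v y w\<close> changes the content of the new vertex
  \<open>v\<close>. Whether \<open>v\<close> joins the parity set is dictated by the demand that
  \<open>{v, y, w}\<close> meet it in an even number of vertices.\<close>

lemma controlled_insert:
  assumes ctl: "controlled A S L" and "S \<subseteq> V" "A \<subseteq> S"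
    and v: "adj v y" "v \<notin> S"
    and yw: "adj y w" "y \<in> S" "w \<in> S"
    and jk: "j \<in> A" "k \<in> A" "j \<noteq> k" "j \<notin> {y, w}" "k \<notin> {y, w}"
    and e: "e \<in> L" "e \<notin> {w, j, k}"
  shows "controlled A (insert v S) (if (y \<in> L) \<noteq> (w \<in> L) then insert v L else L)"
    (is "controlled A ?S ?L")
proof -
  have LS: "L \<subseteq> S" using ctl by (simp add: controlled_def)
  have ctlD: "eqv Q Q'" if "Q \<subseteq> V" "Q' \<subseteq> V" "live A Q" "live A Q'" "Q - S = Q' - S"
      "par ?L Q = par ?L Q'" for Q Q'
  proof -
    have "?L \<inter> S = L \<inter> S" using v by auto
    then have "par L Q = par L Q'"
      using par_eq_cong that finite_V finite_subset by metis
    then show ?thesis using ctl that unfolding controlled_def by blast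
  qed
  have ne: "v \<noteq> y" "v \<noteq> w" "y \<noteq> w" using v yw adj_irrefl by auto
  have vw: "\<not> par ?L {v, y, w}" using ne LS v yw by (auto split: if_splits)
  have main: "eqv Q Q'"
    if h: "Q \<subseteq> V" "Q' \<subseteq> V" "live A Q" "live A Q'" "Q - ?S = Q' - ?S" "par ?L Q = par ?L Q'"
      "v \<in> Q" "v \<notin> Q'" for Q Q'
  proof -
    \<comment> \<open>\<open>R\<close> is reached from \<open>Q\<close> inside \<open>S\<close> and lets the move along \<open>v y w\<close> remove the peg at \<open>v\<close>;
      \<open>j\<close> and \<open>k\<close> keep it live before and after, \<open>e\<close> adjusts the parity.\<close>
    define R1 where "R1 = (Q - S) \<union> {j}"
    define R where "R = (if par ?L R1 = par ?L Q then R1 else insert e R1)"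
    have eS: "e \<in> S" "j \<in> S" "k \<in> S" using e LS jk \<open>A \<subseteq> S\<close> by auto
    have R1: "finite R1" "e \<notin> R1" "R1 \<subseteq> V"
      using h eS e finite_V \<open>S \<subseteq> V\<close> by (auto simp: R1_def intro: finite_subset)
    have "par ?L (insert e R1) \<longleftrightarrow> \<not> par ?L R1"
      using R1 e by simp
    then have parR: "par ?L R = par ?L Q" by (auto simp: R_def)
    have R: "R \<subseteq> V" "R - S = Q - S" "v \<in> R" "w \<notin> R" "j \<in> R" "k \<notin> R"
      using R1 eS e h jk v yw \<open>S \<subseteq> V\<close> by (auto simp: R_def R1_def)
    define R2 where "R2 = flip {v, y, w} R"
    have "live A R" using jk R by (intro liveI[of j _ k])
    then have "eqv Q R" using ctlD[of Q R] h R parR by simp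
    also have "eqv R R2"
      by (rule eqv_flip[of v y w]) (use v yw R R2_def in auto)
    also have "eqv R2 Q'"
    proof (rule ctlD)
      show "R2 \<subseteq> V" using \<open>eqv R R2\<close> R eqv_subset by blast
      show "live A R2" by (rule liveI[of j _ k]) (use jk R R2_def eS v in auto)
      show "R2 - S = Q' - S"
        using R(2,3) h(5,7,8) v yw unfolding R2_def by (auto simp: set_eq_iff)
      have "finite R" using R finite_V finite_subset by auto
      then have "par ?L R2 = par ?L R"
        using vw par_flip[of "{v, y, w}" R] by (simp add: R2_def)
      then show "par ?L R2 = par ?L Q'" using h parR by simp
    qed (use h in auto)
    finally show ?thesis .
  qed
  show ?thesis
    unfolding controlled_def
  proof (intro conjI allI impI)
    show "?L \<subseteq> ?S" using LS by auto
    fix Q Q'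
    assume h: "Q \<subseteq> V" "Q' \<subseteq> V" "live A Q" "live A Q'" "Q - ?S = Q' - ?S" "par ?L Q = par ?L Q'"
    show "eqv Q Q'"
    proof (cases "v \<in> Q \<longleftrightarrow> v \<in> Q'")
      case True
      then have "Q - S = Q' - S" using h(5) by blast
      then show ?thesis using ctlD h by blast
    next
      case False
      then show ?thesis using main[of Q Q'] main[of Q' Q] h eqv_sym by metis
    qed
  qed
qed

lemma boundary_edge:
  assumes "S \<subseteq> V" "S \<noteq> V" "s \<in> S"
  obtains v y where "v \<in> V" "v \<notin> S" "y \<in> S" "adj v y"
proof -
  obtain t where t: "t \<in> V" "t \<notin> S" using assms by blast
  have "adj\<^sup>*\<^sup>* s t" using connected_V t assms by blast
  then have "\<exists>v y. v \<in> V \<and> v \<notin> S \<and> y \<in> S \<and> adj v y"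
    using t(2)
  proof (induction rule: rtranclp_induct)
    case base
    then show ?case using assms by simp
  next
    case (step y z)
    then show ?case using adj_sym adj_V by metis
  qed
  then show thesis using that by blast
qed

lemma triple_first:
  assumes "x \<in> {a, b, c}" "a \<noteq> b" "b \<noteq> c" "a \<noteq> c"
  obtains j k where "{x, j, k} = {a, b, c}" "j \<noteq> k" "x \<noteq> j" "x \<noteq> k"
proof -
  from assms(1) consider "x = a" | "x = b" | "x = c" by blast
  then show thesis
  proof cases
    case 1
    then show ?thesis using that[of b c] assms by auto
  next
    case 2
    then show ?thesis using that[of a c] assms by auto
  next
    case 3
    then show ?thesis using that[of a b] assms by auto
  qed
qed

text \<open>Induction on the number of vertices outside \<open>S\<close>, each step absorbing one by
  \<open>controlled_insert\<close>. Keeping \<open>L' \<inter> S = L\<close> preserves the leaves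
  and \<open>d\<close> inside the parity set and \<open>u\<close> outside it.\<close>

lemma controlled_extend:
  assumes adj: "adj u a" "adj u b" "adj u c" and distinct: "a \<noteq> b" "b \<noteq> c" "a \<noteq> c"
    and ctl: "controlled {a, b, c} S L" and S: "S \<subseteq> V" "{u, a, b, c} \<subseteq> S"
    and L: "{a, b, c} \<subseteq> L" "u \<notin> L" and d: "d \<in> L" "d \<notin> {a, b, c}"
    and nbr: "\<forall>y\<in>S. \<exists>w\<in>S. adj y w"
  shows "\<exists>L'. controlled {a, b, c} V L' \<and> L' \<inter> S = L"
  using ctl S L d nbr
proof (induction "card (V - S)" arbitrary: S L rule: less_induct)
  case less
  show ?case
  proof (cases "S = V")
    case True
    have "L \<subseteq> S" using less.prems(1) by (simp add: controlled_def)
    then show ?thesis using less.prems(1) True by blast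
  next
    case False
    obtain v y where v: "v \<in> V" "v \<notin> S" "y \<in> S" "adj v y"
      using boundary_edge[of S u] less.prems False by auto
    have au: "adj a u" "adj b u" "adj c u" using adj adj_sym by auto
    have ne: "a \<noteq> u" "b \<noteq> u" "c \<noteq> u" using adj adj_irrefl by auto
    \<comment> \<open>If \<open>y\<close> is a leaf, take \<open>w = u\<close>, the other two leaves
      for \<open>j\<close>, \<open>k\<close>, and \<open>e = y\<close>. If only \<open>w\<close> is
      a leaf, the other two serve again and the extra element \<open>d\<close> becomes
      \<open>e\<close>. Otherwise the three leaves provide \<open>j\<close>, \<open>k\<close> and
      \<open>e\<close>.\<close>
    have "\<exists>w j k e. w \<in> S \<and> adj y w \<and> j \<in> {a, b, c} \<and> k \<in> {a, b, c} \<and> j \<noteq> k \<and>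
        j \<notin> {y, w} \<and> k \<notin> {y, w} \<and> e \<in> L \<and> e \<notin> {w, j, k}"
    proof (cases "y \<in> {a, b, c}")
      case True
      then obtain j k where jk: "{y, j, k} = {a, b, c}" "j \<noteq> k" "y \<noteq> j" "y \<noteq> k"
        by (rule triple_first) (use distinct in auto)
      have "adj y u" "y \<noteq> u" using True au ne by auto
      moreover have "j \<in> {a, b, c}" "k \<in> {a, b, c}" using jk(1) by blast+
      moreover from this have "u \<notin> {j, k}" using ne by auto
      ultimately show ?thesis using jk(2-4) True less.prems(3,4)
        by (intro exI[of _ u] exI[of _ j] exI[of _ k] exI[of _ y]) auto
    next
      case False
      obtain w where w: "w \<in> S" "adj y w" using less.prems(8) v(3) by blast
      show ?thesis
      proof (cases "w \<in> {a, b, c}")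
        case True
        then obtain j k where jk: "{w, j, k} = {a, b, c}" "j \<noteq> k" "w \<noteq> j" "w \<noteq> k"
          by (rule triple_first) (use distinct in auto)
        have "j \<in> {a, b, c}" "k \<in> {a, b, c}" using jk(1) by blast+
        then show ?thesis using jk(2-4) True False w less.prems(6,7)
          by (intro exI[of _ w] exI[of _ j] exI[of _ k] exI[of _ d]) auto
      next
        case w_out: False
        then show ?thesis using w w_out less.prems(4) distinct False
          by (intro exI[of _ w] exI[of _ b] exI[of _ c] exI[of _ a]) auto
      qed
    qed
    then obtain w j k e where wjke: "w \<in> S" "adj y w" "j \<in> {a, b, c}" "k \<in> {a, b, c}" "j \<noteq> k"
        "j \<notin> {y, w}" "k \<notin> {y, w}" "e \<in> L" "e \<notin> {w, j, k}"
      by blast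
    define L1 where "L1 = (if (y \<in> L) \<noteq> (w \<in> L) then insert v L else L)"
    have LS: "L \<subseteq> S" using less.prems(1) by (simp add: controlled_def)
    have L1: "L1 \<inter> S = L" using LS v(2) by (auto simp: L1_def)
    have "controlled {a, b, c} (insert v S) L1"
      unfolding L1_def using controlled_insert less.prems(1-3) v wjke by simp
    moreover have "card (V - insert v S) < card (V - S)"
      by (rule psubset_card_mono) (use finite_V v in auto)
    moreover have "\<forall>y\<in>insert v S. \<exists>w\<in>insert v S. adj y w" using less.prems(8) v by blast
    moreover have "u \<notin> L1" "{a, b, c} \<subseteq> L1" "d \<in> L1"
      using less.prems(3-7) L1 by blast+
    ultimately obtain L' where "controlled {a, b, c} V L'" "L' \<inter> insert v S = L1"
      using less.hyps[of "insert v S" L1] less.prems(2,3,7) v by auto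
    moreover from this have "L' \<inter> S = L" using L1 by blast
    ultimately show ?thesis by blast
  qed
qed

definition branch :: "'a \<Rightarrow> bool" where
  "branch u \<longleftrightarrow> (\<exists>a b c. adj u a \<and> adj u b \<and> adj u c \<and> a \<noteq> b \<and> b \<noteq> c \<and> a \<noteq> c)"

text \<open>Inserting \<open>d\<close> along \<open>d a u\<close> puts it into the parity set, since
  \<open>a\<close> is in and \<open>u\<close> is not. Thus \<open>d\<close> is the extra element
  that \<open>controlled_extend\<close> requires.\<close>

lemma controlled_fork:
  assumes adj: "adj u a" "adj u b" "adj u c" "adj a d" and distinct: "a \<noteq> b" "b \<noteq> c" "a \<noteq> c"
    and d: "d \<notin> {u, a, b, c}"
  shows "\<exists>L. controlled {a, b, c} V L \<and> {a, b, c, d} \<subseteq> L \<and> u \<notin> L"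
proof -
  have adj': "adj a u" "adj b u" "adj c u" "adj d a" using adj adj_sym by auto
  have ne: "a \<noteq> u" "b \<noteq> u" "c \<noteq> u" using adj adj_irrefl by auto
  have V: "{u, a, b, c} \<subseteq> V" "d \<in> V" using adj adj_V adj_V2 by auto
  have "controlled {a, b, c} (insert d {u, a, b, c})
      (if (a \<in> {a, b, c}) \<noteq> (u \<in> {a, b, c}) then insert d {a, b, c} else {a, b, c})"
    by (rule controlled_insert[of _ _ _ d a u b c a])
      (use controlled_star adj adj' distinct d V ne in auto)
  then have "controlled {a, b, c} (insert d {u, a, b, c}) (insert d {a, b, c})"
    using ne by simp
  then obtain L' where L': "controlled {a, b, c} V L'"
      "L' \<inter> insert d {u, a, b, c} = insert d {a, b, c}"
    using controlled_extend[OF adj(1-3) distinct, of "insert d {u, a, b, c}" "insert d {a, b, c}" d]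
      V ne d adj adj' by auto
  have "u \<notin> insert d {a, b, c}" using ne d by auto
  then have "u \<notin> L'" using L'(2) by blast
  moreover have "{a, b, c, d} \<subseteq> L'" using L'(2) by blast
  ultimately show ?thesis using L'(1) by blast
qed

text \<open>
  If no fork \<open>d - a - u\<close> with two more leaves \<open>b\<close>, \<open>c\<close> exists, then \<open>u\<close> and its three neighbours are
  the whole graph, and \<open>d\<close> is one of them.
\<close>

lemma controlled_exists:
  assumes "branch u" "adj u a'" "adj a' d'" "d' \<noteq> u"
  obtains a b c d L where "adj u a" "adj u b" "adj u c" "adj a d" "d \<noteq> u"
    "a \<noteq> b" "b \<noteq> c" "a \<noteq> c" "controlled {a, b, c} V L" "{a, b, c, d} \<subseteq> L" "u \<notin> L"
proof (cases "\<exists>a b c d. adj u a \<and> adj u b \<and> adj u c \<and> adj a d \<and> a \<noteq> b \<and> b \<noteq> c \<and> a \<noteq> c \<and> d \<notin> {u, a, b, c}")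
  case True
  then obtain a b c d where *: "adj u a" "adj u b" "adj u c" "adj a d" "a \<noteq> b" "b \<noteq> c" "a \<noteq> c"
      "d \<notin> {u, a, b, c}"
    by blast
  then show thesis using controlled_fork[OF *] that by blast
next
  case False
  then have nofork: "d \<in> {u, a, b, c}" if "adj u a" "adj u b" "adj u c" "adj a d"
      "a \<noteq> b" "b \<noteq> c" "a \<noteq> c" for a b c d
    using that by blast
  have "d' \<noteq> a'" using assms adj_irrefl by blast
  have two: "\<exists>b c. adj u b \<and> adj u c \<and> b \<noteq> c \<and> b \<noteq> a' \<and> c \<noteq> a'"
    using assms(1) unfolding branch_def by metis
  then have ud: "adj u d'"
    using nofork[of a' _ _ d'] assms \<open>d' \<noteq> a'\<close> by (metis insertE singletonD)
  obtain c where c: "adj u c" "c \<noteq> a'" "c \<noteq> d'"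
    using assms(1) unfolding branch_def by metis
  \<comment> \<open>Any further neighbour \<open>x\<close> of \<open>u\<close> would give the fork
    \<open>d' - a' - u\<close> with leaves \<open>c\<close> and \<open>x\<close>.\<close>
  have nb: "x \<in> {a', d', c}" if "adj u x" for x
    using nofork[of a' c x d'] that assms c \<open>d' \<noteq> a'\<close> by (metis insertE insertI1 insertI2 singletonD)
  have nb2: "x \<in> {u, a', d', c}" if "adj y x" "y \<in> {a', d', c}" for x y
    using that nofork[of a' d' c x] nofork[of d' a' c x] nofork[of c a' d' x] assms c ud
      \<open>d' \<noteq> a'\<close> by auto
  have V: "{u, a', d', c} = V"
  proof (rule ccontr)
    assume "{u, a', d', c} \<noteq> V"
    moreover have "{u, a', d', c} \<subseteq> V" using assms c adj_V adj_V2 by auto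
    ultimately obtain v y where vy: "v \<notin> {u, a', d', c}" "y \<in> {u, a', d', c}" "adj v y"
      using boundary_edge[of "{u, a', d', c}" u] by (metis insertI1)
    have "adj y v" using vy adj_sym by blast
    then show False using nb[of v] nb2[of y v] vy by auto
  qed
  have "controlled {a', d', c} {u, a', d', c} {a', d', c}"
    by (rule controlled_star) (use assms c ud \<open>d' \<noteq> a'\<close> in auto)
  moreover have "u \<notin> {a', d', c}" using assms c ud adj_irrefl by auto
  ultimately show thesis
    using that[of a' d' c d' "{a', d', c}"] assms c ud \<open>d' \<noteq> a'\<close> by (simp add: V)
qed


section \<open>Invariant parities\<close>

text \<open>Every path \<open>x y z\<close> meets \<open>L\<close> in an even number of vertices:
  over the field with two elements, the indicator of \<open>L\<close> sums to zero along it.\<close>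

definition valid :: "'a set \<Rightarrow> bool" where
  "valid L \<longleftrightarrow> (\<forall>x y z. adj x y \<longrightarrow> adj y z \<longrightarrow> x \<noteq> z \<longrightarrow> (y \<in> L \<longleftrightarrow> (x \<in> L) \<noteq> (z \<in> L)))"

lemma validD:
  "valid L \<Longrightarrow> adj x y \<Longrightarrow> adj y z \<Longrightarrow> x \<noteq> z \<Longrightarrow> y \<in> L \<longleftrightarrow> (x \<in> L) \<noteq> (z \<in> L)"
  unfolding valid_def by metis

lemma par_path:
  assumes "adj x y" "adj y z" "x \<noteq> z"
  shows "par L {x, y, z} \<longleftrightarrow> \<not> (y \<in> L \<longleftrightarrow> (x \<in> L) \<noteq> (z \<in> L))"
proof -
  have "x \<noteq> y" "y \<noteq> z" using assms adj_irrefl by auto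
  then show ?thesis using assms by auto
qed

lemma par_move:
  assumes "valid L" "move P Q" "finite P"
  shows "par L Q = par L P"
proof -
  obtain x y z where *: "adj x y" "adj y z" "x \<in> P" "z \<notin> P" "Q = flip {x, y, z} P"
    using assms by (auto simp: move_def)
  then have xz: "x \<noteq> z" by auto
  have "\<not> par L {x, y, z}"
    using par_path[OF *(1,2) xz] validD[OF assms(1) *(1,2) xz] by blast
  then show ?thesis using *(5) assms(3) par_flip[of "{x, y, z}" P L] by simp
qed

lemma par_eqv:
  assumes "valid L" "eqv P Q" "P \<subseteq> V"
  shows "par L Q = par L P"
  using assms(2) unfolding eqv_def
proof (induction rule: rtranclp_induct)
  case (step Q R)
  then have "finite Q"
    using eqv_subset assms(3) finite_V finite_subset by (metis eqv_def)
  then show ?case using step par_move assms(1) by blast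
qed simp

text \<open>Modulo 2 the indicator at \<open>u\<close> is the sum over each pair among three
  neighbours. Adding the three equations counts every neighbour twice, so the value at
  \<open>u\<close> is zero.\<close>

lemma valid_branch:
  assumes "valid L" "branch u"
  shows "u \<notin> L"
proof -
  obtain a b c where *: "adj u a" "adj u b" "adj u c" "a \<noteq> b" "b \<noteq> c" "a \<noteq> c"
    using assms(2) by (auto simp: branch_def)
  then have "u \<in> L \<longleftrightarrow> (a \<in> L) \<noteq> (b \<in> L)" "u \<in> L \<longleftrightarrow> (b \<in> L) \<noteq> (c \<in> L)"
    "u \<in> L \<longleftrightarrow> (a \<in> L) \<noteq> (c \<in> L)"
    using validD[OF assms(1)] adj_sym * by blast+
  then show ?thesis by blast
qed

section \<open>Paths, closed paths and the pattern of an invariant set along them\<close>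

text \<open>Counterpart of \<open>path_joining\<close> over \<open>adj\<close>. A closed path
  repeats its start, so at least 3 edges means at least 4 entries.\<close>

definition linked :: "'a \<Rightarrow> 'a list \<Rightarrow> 'a \<Rightarrow> bool" where
  "linked s p t \<longleftrightarrow> p \<noteq> [] \<and> hd p = s \<and> last p = t \<and> successively adj p \<and>
     (distinct p \<or> s = t \<and> distinct (tl p) \<and> 4 \<le> length p)"

text \<open>Supplies the condition \<open>x \<noteq> z\<close> of \<open>valid\<close>. On a closed
  path only the first and last entries coincide, and they are at least three positions
  apart.\<close>

lemma linked_gap:
  assumes "linked s p t" "Suc (Suc i) < length p"
  shows "p ! i \<noteq> p ! Suc (Suc i)"
proof (cases "distinct p")
  case True
  then show ?thesis using assms by (simp add: nth_eq_iff_index_eq)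
next
  case False
  then have p: "s = t" "distinct (tl p)" "4 \<le> length p" "p \<noteq> []" "hd p = s" "last p = t"
    using assms by (auto simp: linked_def)
  show ?thesis
  proof (cases i)
    case 0
    \<comment> \<open>The first entry equals the last one, which is the final entry of the distinct
      list \<open>tl p\<close>.\<close>
    have "p ! i = tl p ! (length p - 2)"
      using p 0 by (simp add: hd_conv_nth[symmetric] last_conv_nth nth_tl
          Suc_diff_Suc numeral_2_eq_2)
    moreover have "p ! Suc (Suc i) = tl p ! Suc i"
      using assms by (simp add: nth_tl)
    moreover have "tl p ! Suc i \<noteq> tl p ! (length p - 2)"
      using p assms 0 by (subst nth_eq_iff_index_eq) auto
    ultimately show ?thesis by simp
  next
    case (Suc k)
    have "tl p ! k \<noteq> tl p ! Suc (Suc k)"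
      using p assms Suc by (subst nth_eq_iff_index_eq) auto
    then show ?thesis using assms Suc by (simp add: nth_tl)
  qed
qed

text \<open>Along \<open>p\<close>, validity is the Fibonacci recurrence modulo 2. From the initial
  values 0, 1 it yields 0, 1, 1 with period 3.\<close>

lemma valid_pattern:
  assumes "valid L" "linked s p t" "s \<notin> L" "\<And>x. adj s x \<Longrightarrow> x \<in> L" "i < length p"
  shows "p ! i \<in> L \<longleftrightarrow> \<not> 3 dvd i"
  using assms(5)
proof (induction i rule: less_induct)
  case (less i)
  have suc: "adj (p ! j) (p ! Suc j)" if "Suc j < length p" for j
    using that assms(2) successively_nth by (auto simp: linked_def)
  have hd: "p ! 0 = s" using assms(2) by (auto simp: linked_def hd_conv_nth)
  consider "i = 0" | "i = 1" | j where "i = Suc (Suc j)"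
    by (metis One_nat_def not0_implies_Suc)
  then show ?case
  proof cases
    case 1
    then show ?thesis using hd assms by simp
  next
    case 2
    then show ?thesis using hd suc[of 0] less.prems assms(4) by simp
  next
    case 3
    have "p ! Suc j \<in> L \<longleftrightarrow> (p ! j \<in> L) \<noteq> (p ! i \<in> L)"
      using validD[OF assms(1) suc[of j] suc[of "Suc j"]] linked_gap[OF assms(2), of j] less.prems 3
      by auto
    moreover have "p ! j \<in> L \<longleftrightarrow> \<not> 3 dvd j" "p ! Suc j \<in> L \<longleftrightarrow> \<not> 3 dvd Suc j"
      using less 3 by auto
    moreover have "(\<not> 3 dvd Suc j) = ((\<not> 3 dvd j) \<noteq> (\<not> 3 dvd Suc (Suc j)))"
      by presburger
    ultimately show ?thesis unfolding 3 by blast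
  qed
qed

text \<open>If \<open>L\<close> is not valid, some path \<open>x y z\<close> meets it in an odd
  number of vertices. One move along that path between two live configurations then joins the two
  parity classes, so all live configurations are equivalent.\<close>

lemma controlled_dichotomy:
  assumes ctl: "controlled {a, b, c} V L" and V: "{a, b, c} \<subseteq> V"
    and distinct: "a \<noteq> b" "b \<noteq> c" "a \<noteq> c"
    and P: "P \<subseteq> V" "Q \<subseteq> V" "live {a, b, c} P" "live {a, b, c} Q"
  shows "valid L \<or> eqv P Q"
proof (rule disjCI)
  assume ne: "\<not> eqv P Q"
  have ctlD: "eqv R R'" if "R \<subseteq> V" "R' \<subseteq> V" "live {a, b, c} R" "live {a, b, c} R'"
      "par L R = par L R'" for R R'
    using ctl that unfolding controlled_def by blast
  show "valid L"
    unfolding valid_def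
  proof (intro allI impI)
    fix x y z
    assume path: "adj x y" "adj y z" "x \<noteq> z"
    have xyz: "x \<in> V" "y \<in> V" "z \<in> V" "x \<noteq> y" "y \<noteq> z"
      using path adj_V adj_V2 adj_irrefl by auto
    have "\<exists>R\<subseteq>V. x \<in> R \<and> z \<notin> R \<and> live {a, b, c} R \<and> live {a, b, c} (flip {x, y, z} R)"
    proof -
      \<comment> \<open>Either two leaves lie on the path, and \<open>R\<close> makes them unlike
        both before and after the move, or two leaves are off the path, and \<open>R\<close> puts a
        peg on just one of them.\<close>
      consider "x \<in> {a, b, c}" "z \<in> {a, b, c}" | "x \<in> {a, b, c}" "y \<in> {a, b, c}"
        | "y \<in> {a, b, c}" "z \<in> {a, b, c}"
        | j k where "j \<in> {a, b, c}" "k \<in> {a, b, c}" "j \<noteq> k" "{j, k} \<inter> {x, y, z} = {}"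
      proof (cases "\<exists>j k. j \<in> {a, b, c} \<and> k \<in> {a, b, c} \<and> j \<noteq> k \<and> {j, k} \<inter> {x, y, z} = {}")
        case True
        then show ?thesis using that by blast
      next
        case False
        then have "\<not> ({a, b} \<inter> {x, y, z} = {})" "\<not> ({b, c} \<inter> {x, y, z} = {})"
            "\<not> ({a, c} \<inter> {x, y, z} = {})"
          using distinct by blast+
        then show ?thesis using that distinct by auto
      qed
      then show ?thesis
      proof cases
        case 1
        show ?thesis
          by (intro exI[of _ "{x}"] conjI liveI[of x _ z] liveI[of z _ x])
            (use 1 path xyz in auto)
      next
        case 2
        show ?thesis
          by (intro exI[of _ "{x}"] conjI liveI[of x _ y] liveI[of y _ x])
            (use 2 path xyz in auto)
      next
        case 3
        show ?thesis
          by (intro exI[of _ "{x, y}"] conjI liveI[of y _ z] liveI[of z _ y])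
            (use 3 path xyz in auto)
      next
        case 4
        show ?thesis
          by (intro exI[of _ "{x, j}"] conjI liveI[of j _ k])
            (use 4 path xyz V in auto)
      qed
    qed
    then obtain R where R: "R \<subseteq> V" "x \<in> R" "z \<notin> R" "live {a, b, c} R"
        "live {a, b, c} (flip {x, y, z} R)"
      by blast
    have RR: "eqv R (flip {x, y, z} R)" using eqv_flip path R by blast
    then have R': "flip {x, y, z} R \<subseteq> V" using eqv_subset R by blast
    have "finite R" using R finite_V finite_subset by auto
    then have pR: "par L (flip {x, y, z} R) \<longleftrightarrow> par L R \<noteq> par L {x, y, z}"
      by (simp only: par_flip finite.intros)
    show "y \<in> L \<longleftrightarrow> (x \<in> L) \<noteq> (z \<in> L)"
    proof (rule ccontr)
      assume "\<not> ?thesis"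
      then have "par L {x, y, z}" using par_path path by blast
      then have "par L (flip {x, y, z} R) \<noteq> par L R" using pR by blast
      \<comment> \<open>The parity of \<open>R'\<close> agrees with that of \<open>R\<close> or with
        that of its successor.\<close>
      then have "eqv R' R" if "R' \<subseteq> V" "live {a, b, c} R'" for R'
        using that ctlD[of R' R] ctlD[of R' "flip {x, y, z} R"] R R' RR eqv_sym eqv_trans by metis
      then show False using ne P eqv_sym eqv_trans by metis
    qed
  qed
qed

section \<open>Distances from the branch vertex\<close>

text \<open>Graph distance; for vertices in \<open>V\<close>, connectedness guarantees that the
  least number exists.\<close>

definition hops :: "'a \<Rightarrow> 'a \<Rightarrow> nat" where
  "hops u v = (LEAST n. (adj ^^ n) u v)"

lemma relpowp_hops: "u \<in> V \<Longrightarrow> v \<in> V \<Longrightarrow> (adj ^^ hops u v) u v"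
  unfolding hops_def using connected_V rtranclp_imp_relpowp by (metis LeastI)

lemma hops_le: "(adj ^^ n) u v \<Longrightarrow> hops u v \<le> n"
  unfolding hops_def by (rule Least_le)

lemma hops_self [simp]: "hops u u = 0"
  using hops_le[of 0 u u] by simp

lemma hops_eq_0: "u \<in> V \<Longrightarrow> v \<in> V \<Longrightarrow> hops u v = 0 \<longleftrightarrow> v = u"
  using relpowp_hops[of u v] by (metis hops_self relpowp_0_E)

lemma hops_adj:
  assumes "u \<in> V" "adj x y"
  shows "hops u y \<le> Suc (hops u x)"
proof -
  have "(adj ^^ hops u x) u x" using assms relpowp_hops adj_V by blast
  then show ?thesis using assms hops_le relpowp_Suc_I by metis
qed

lemma hops_pred:
  assumes "u \<in> V" "v \<in> V" "hops u v = Suc n"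
  obtains w where "adj w v" "hops u w = n"
proof -
  have "(adj ^^ Suc n) u v" using assms relpowp_hops by metis
  then obtain w where w: "(adj ^^ n) u w" "adj w v" by (auto elim: relpowp_Suc_E)
  then have "hops u w \<le> n" using hops_le by blast
  moreover have "Suc n \<le> Suc (hops u w)" using assms hops_adj w by metis
  ultimately show thesis using that w by auto
qed

section \<open>Reaching live configurations from one peg or one hole\<close>

text \<open>Induction on the distance from \<open>u\<close>. A peg far away is brought inwards;
  within distance 2, at most two moves put a peg on a leaf while at most two pegs are present. For a
  peg on \<open>u\<close> itself, \<open>d\<close> permits an unjump to
  \<open>{a, d}\<close>.\<close>

lemma single_live:
  assumes adj: "adj u a" "adj u b" "adj u c" "adj a d" "d \<noteq> u"
    and distinct: "a \<noteq> b" "b \<noteq> c" "a \<noteq> c" and "v \<in> V"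
  shows "\<exists>Q. live {a, b, c} Q \<and> eqv {v} Q"
  using assms(9)
proof (induction "hops u v" arbitrary: v rule: less_induct)
  case less
  have uV: "u \<in> V" using adj adj_V by blast
  have adj': "adj a u" "adj b u" "adj c u" "adj d a" using adj adj_sym by auto
  have ne: "a \<noteq> u" "b \<noteq> u" "c \<noteq> u" "d \<noteq> a" using adj adj_irrefl by auto
  have two: "live {a, b, c} {y, z}" if "y \<in> {a, b, c}" for y z
    using that distinct by (auto simp: live_def)
  have one: "live {a, b, c} {y}" if "y \<in> {a, b, c}" for y
    using two[of y y] that by simp
  \<comment> \<open>A single peg turns into a pair by an unjump and then into a single peg three steps
    closer to \<open>u\<close>.\<close>
  consider "hops u v = 0" | "hops u v = 1" | k where "hops u v = Suc (Suc k)"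
    by (metis One_nat_def not0_implies_Suc)
  then show ?case
  proof cases
    case 1
    then have "v = u" using hops_eq_0 uV less.prems by blast
    then have "eqv {v} {a, d}"
      using eqv_flip[of u a d "{u}" "{a, d}"] adj ne by (auto simp: set_eq_iff)
    then show ?thesis using two by blast
  next
    case 2
    then obtain w where w: "adj w v" "hops u w = 0"
      using hops_pred[of u v 0] uV less.prems by auto
    then have uv: "adj u v" using hops_eq_0 uV adj_V by metis
    show ?thesis
    proof (cases "v \<in> {a, b, c}")
      case True
      then show ?thesis using one eqv_refl by blast
    next
      case False
      have "v \<noteq> u" using uv adj_irrefl by blast
      then have "eqv {v} {a, u}"
        using eqv_flip[of v u a "{v}" "{a, u}"] adj uv adj_sym ne False by (auto simp: set_eq_iff)
      then show ?thesis using two by blast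
    qed
  next
    case 3
    obtain p where p: "adj p v" "hops u p = Suc k"
      using hops_pred[of u v "Suc k"] uV less.prems 3 by auto
    obtain q where q: "adj q p" "hops u q = k"
      using hops_pred[of u p k] uV p adj_V by metis
    have vq: "v \<noteq> q" "v \<noteq> p" "p \<noteq> q" using 3 p q by auto
    have vpq: "eqv {v} {p, q}"
      using eqv_flip[of v p q "{v}" "{p, q}"] p q adj_sym vq by (auto simp: set_eq_iff)
    show ?thesis
    proof (cases k)
      case 0
      then have qu: "q = u" using hops_eq_0 uV q adj_V by metis
      show ?thesis
      proof (cases "p \<in> {a, b, c}")
        case True
        then show ?thesis using two vpq by blast
      next
        case False
        have "eqv {p, q} {a}"
          using eqv_flip[of p u a "{p, q}" "{a}"] adj q adj_sym ne False vq qu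
          by (auto simp: set_eq_iff)
        then show ?thesis using one vpq eqv_trans by blast
      qed
    next
      case (Suc l)
      obtain r where r: "adj r q" "hops u r = l"
        using hops_pred[of u q l] uV q adj_V Suc by metis
      have ner: "r \<noteq> q" "r \<noteq> p" using p q r Suc by auto
      have "eqv {p, q} {r}"
        using eqv_flip[of p q r "{p, q}" "{r}"] q r adj_sym vq ner by (auto simp: set_eq_iff)
      then have "eqv {v} {r}" using vpq eqv_trans by blast
      moreover obtain Q where "live {a, b, c} Q" "eqv {r} Q"
        using less.hyps[of r] r 3 Suc adj_V by auto
      ultimately show ?thesis using eqv_trans by blast
    qed
  qed
qed

text \<open>Being live is unaffected by exchanging pegs and holes, so \<open>single_live\<close>
  carries over through \<open>eqv_compl\<close>.\<close>

lemma hole_live: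
  assumes adj: "adj u a" "adj u b" "adj u c" "adj a d" "d \<noteq> u"
    and distinct: "a \<noteq> b" "b \<noteq> c" "a \<noteq> c" and "v \<in> V"
  shows "\<exists>Q. live {a, b, c} Q \<and> eqv (V - {v}) Q"
proof -
  obtain Q where Q: "live {a, b, c} Q" "eqv {v} Q"
    using single_live assms by blast
  have "{a, b, c} \<subseteq> V" using adj adj_V2 by auto
  then have "live {a, b, c} (V - Q)" using Q(1) by (auto simp: live_def)
  then show ?thesis using eqv_compl[OF Q(2)] assms by blast
qed


section \<open>Shortest paths and the cycles they close\<close>

text \<open>Shortest paths from \<open>u\<close>, encoded so that a vertex can occur only at the
  index equal to its distance.\<close>

definition geodesic :: "'a \<Rightarrow> 'a list \<Rightarrow> bool" where
  "geodesic u p \<longleftrightarrow> p \<noteq> [] \<and> hd p = u \<and> successively adj p \<and> (\<forall>i<length p. hops u (p ! i) = i)"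

lemma geodesic_snoc:
  assumes "geodesic u p" "adj (last p) v" "hops u v = length p"
  shows "geodesic u (p @ [v])"
  using assms by (auto simp: geodesic_def successively_append_iff nth_append less_Suc_eq)

lemma geodesic_length:
  assumes "geodesic u p"
  shows "length p = Suc (hops u (last p))"
  using assms by (auto simp: geodesic_def last_conv_nth)

lemma geodesic_distinct: "geodesic u p \<Longrightarrow> distinct p"
  unfolding geodesic_def distinct_conv_nth by metis

lemma geodesic_nth:
  assumes "geodesic u p" "x \<in> set p"
  shows "hops u x < length p" "p ! hops u x = x"
  using assms by (auto simp: geodesic_def in_set_conv_nth)

lemma geodesic_exists:
  assumes "u \<in> V" "v \<in> V"
  obtains p where "geodesic u p" "last p = v"
proof -
  have "\<exists>p. geodesic u p \<and> last p = v"
    using assms(2)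
  proof (induction "hops u v" arbitrary: v)
    case 0
    then have "v = u" using hops_eq_0 assms by auto
    then show ?case by (intro exI[of _ "[u]"]) (simp add: geodesic_def)
  next
    case (Suc n)
    obtain w where w: "adj w v" "hops u w = n"
      using hops_pred assms(1) Suc.prems Suc.hyps(2) by metis
    then obtain p where p: "geodesic u p" "last p = w"
      using Suc.hyps(1) adj_V by metis
    have "hops u v = length p" using geodesic_length[OF p(1)] p w Suc.hyps(2) by simp
    then have "geodesic u (p @ [v])" using geodesic_snoc p w by blast
    then show ?case by (intro exI[of _ "p @ [v]"]) simp
  qed
  then show thesis using that by blast
qed

text \<open>Let \<open>s\<close> be the last common vertex of \<open>P\<close> and \<open>Q\<close>.
  Their tails after \<open>s\<close> are disjoint, and the edge between their ends closes them to a
  cycle \<open>C\<close> through \<open>s\<close>. The list \<open>C\<close> contains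
  \<open>s\<close> twice, hence the summand 2.\<close>

lemma geodesic_cycle:
  assumes geo: "geodesic u P" "geodesic u Q" and adj: "adj (last P) (last Q)"
    and notin: "last P \<notin> set Q" "last Q \<notin> set P" and "branch u"
  obtains s C where "branch s" "linked s C s"
    "length C + 2 * hops u s = hops u (last P) + hops u (last Q) + 2"
proof -
  \<comment> \<open>Indices are distances, so \<open>P\<close> and \<open>Q\<close> can share a
    vertex only at equal indices; the maximum of \<open>I\<close> is where they separate for
    good.\<close>
  define I where "I = {i. i < length P \<and> i < length Q \<and> P ! i = Q ! i}"
  have ne: "P \<noteq> []" "Q \<noteq> []" "hd P = u" "hd Q = u" "successively adj P" "successively adj Q"
    using geo by (auto simp: geodesic_def)
  have "0 \<in> I" using ne by (auto simp: I_def hd_conv_nth)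
  have "finite I" by (rule finite_subset[of _ "{..<length P}"]) (auto simp: I_def)
  define i where "i = Max I"
  have "i \<in> I" using Max_in \<open>finite I\<close> \<open>0 \<in> I\<close> i_def by blast
  then have i: "i < length P" "i < length Q" "P ! i = Q ! i" by (auto simp: I_def)
  have i_max: "j \<notin> I" if "i < j" for j
    using Max_ge[OF \<open>finite I\<close>, of j] that i_def by auto
  define s where "s = P ! i"
  have hops_s: "hops u s = i" using geo i by (auto simp: s_def geodesic_def)
  have "last P = P ! (length P - 1)" "last Q = Q ! (length Q - 1)"
    using ne by (auto simp: last_conv_nth)
  moreover have "last P \<noteq> s" using notin i s_def by (metis nth_mem)
  moreover have "last Q \<noteq> s" using notin i s_def by (metis nth_mem)
  ultimately have Suc_i: "Suc i < length P" "Suc i < length Q"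
    using i s_def by (metis Suc_lessI diff_Suc_1)+
  define P' where "P' = drop (Suc i) P"
  define Q' where "Q' = drop (Suc i) Q"
  have drop: "drop i P = s # P'" "drop i Q = s # Q'"
    using Cons_nth_drop_Suc[OF i(1)] Cons_nth_drop_Suc[OF i(2)] i(3)
    by (simp_all add: P'_def Q'_def s_def)
  have "distinct (s # P')" "distinct (s # Q')"
    using geo geodesic_distinct distinct_drop drop by metis+
  have "set P' \<inter> set Q' = {}"
  proof (rule ccontr)
    assume "set P' \<inter> set Q' \<noteq> {}"
    then obtain x where x: "x \<in> set P'" "x \<in> set Q'" by blast
    then obtain k where k: "k < length P'" "P' ! k = x" by (metis in_set_conv_nth)
    then have "P ! (Suc i + k) = x" "Suc i + k < length P"
      by (auto simp: P'_def)
    then have hx: "hops u x = Suc i + k" using geo by (auto simp: geodesic_def)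
    have "x \<in> set P" "x \<in> set Q" using x by (auto simp: P'_def Q'_def dest: in_set_dropD)
    then have "hops u x \<in> I" using geodesic_nth geo by (simp add: I_def)
    then show False using i_max[of "hops u x"] hx by simp
  qed
  have nonempty: "P' \<noteq> []" "Q' \<noteq> []" using Suc_i by (auto simp: P'_def Q'_def)
  have succ: "successively adj (s # P')" "successively adj (s # Q')"
    using ne(5,6) successively_append_iff[of adj "take i P" "drop i P"]
      successively_append_iff[of adj "take i Q" "drop i Q"] by (auto simp: drop[symmetric])
  have lasts: "last P' = last P" "last Q' = last Q"
    using Suc_i by (simp_all add: P'_def Q'_def)
  define C where "C = (s # P') @ rev (s # Q')"
  have "linked s C s"
    unfolding linked_def
  proof (intro conjI disjI2)
    have adj_comm: "(\<lambda>x y. adj y x) = adj" using adj_sym by blast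
    have "successively adj (rev (s # Q'))"
      using succ(2) by (simp only: successively_rev adj_comm)
    moreover have "hd (rev (s # Q')) = last Q" using nonempty lasts by (simp add: hd_rev)
    ultimately show "successively adj C"
      unfolding C_def successively_append_iff using succ(1) nonempty lasts adj by simp
    show "distinct (tl C)"
      using \<open>distinct (s # P')\<close> \<open>distinct (s # Q')\<close> \<open>set P' \<inter> set Q' = {}\<close>
      by (auto simp: C_def)
    show "4 \<le> length C" using nonempty by (cases P'; cases Q') (auto simp: C_def)
  qed (auto simp: C_def)
  \<comment> \<open>If \<open>s\<close> is not \<open>u\<close>, it has a predecessor at smaller
    distance and two different successors on \<open>P\<close> and \<open>Q\<close>.\<close>
  moreover have "branch s"
  proof (cases i)
    case 0
    then have "s = u" using ne by (simp add: s_def hd_conv_nth)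
    then show ?thesis using assms by simp
  next
    case (Suc k)
    have "adj (P ! k) s" "adj s (P ! Suc i)" "adj s (Q ! Suc i)"
      using ne(5,6) Suc Suc_i i successively_nth unfolding s_def by metis+
    moreover have "P ! Suc i \<noteq> Q ! Suc i"
      using i_max[of "Suc i"] Suc_i by (auto simp: I_def)
    moreover have "hops u (P ! k) = k" "hops u (P ! Suc i) = Suc i" "hops u (Q ! Suc i) = Suc i"
      using geo Suc Suc_i by (auto simp: geodesic_def)
    ultimately show ?thesis
      using Suc adj_sym unfolding branch_def by (metis lessI less_SucI less_irrefl)
  qed
  moreover have "hops u (last P) = length P - 1" "hops u (last Q) = length Q - 1"
    using geo geodesic_length by auto
  then have "length C + 2 * hops u s = hops u (last P) + hops u (last Q) + 2"
    using Suc_i hops_s by (auto simp: C_def P'_def Q'_def)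
  ultimately show thesis using that by blast
qed

text \<open>Here \<open>h\<close> is the distance of a branch vertex and \<open>k\<close> that of a
  neighbour. The last hypothesis is what an edge within one level will provide; it rules out
  \<open>k = h\<close>.\<close>

lemma residue_branch:
  fixes h k :: nat
  assumes "3 dvd h" "k \<le> Suc h" "h \<le> Suc k" "k \<noteq> h \<or> 3 dvd 2 * h + 1"
  shows "\<not> 3 dvd k"
proof -
  consider "k = h" | "k = Suc h" | "h = Suc k" using assms by linarith
  then show ?thesis by cases (use assms in presburger)+
qed

text \<open>Here \<open>h\<close>, \<open>k\<close>, \<open>l\<close> are the distances of a vertex,
  of a neighbour one step closer to \<open>u\<close>, and of another neighbour. The last two
  hypotheses reflect edges within a level and vertices with two parents.\<close>

lemma residue_two_neighbours:
  fixes h k l :: nat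
  assumes "h = Suc k" "l \<le> Suc h" "h \<le> Suc l" "l \<noteq> h \<or> 3 dvd 2 * h + 1" "Suc l \<noteq> h \<or> 3 dvd h"
  shows "(\<not> 3 dvd h) \<longleftrightarrow> (\<not> 3 dvd k) \<noteq> (\<not> 3 dvd l)"
proof -
  consider "l = h" | "l = Suc h" | "h = Suc l" using assms by linarith
  then show ?thesis by cases (use assms in presburger)+
qed

section \<open>Invariance of the distance classes modulo 3\<close>

context
  fixes u
  assumes branch_u: "branch u"
    and mod3: "\<And>s t p. branch s \<Longrightarrow> branch t \<Longrightarrow> linked s p t \<Longrightarrow> 3 dvd length p - 1"
begin

lemma centre_V: "u \<in> V"
  using branch_u adj_V by (auto simp: branch_def)

text \<open>A shortest path from \<open>u\<close> is itself a path between two branch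
  vertices.\<close>

lemma hops_branch:
  assumes "branch v"
  shows "3 dvd hops u v"
proof -
  have "v \<in> V" using assms adj_V by (auto simp: branch_def)
  then obtain p where p: "geodesic u p" "last p = v" using geodesic_exists centre_V by blast
  then have "linked u p v"
    using geodesic_distinct by (auto simp: linked_def geodesic_def)
  then have "3 dvd length p - 1" using mod3 branch_u assms by blast
  then show ?thesis using geodesic_length p by simp
qed

text \<open>The sum is the length of the cycle from \<open>geodesic_cycle\<close> plus twice the
  distance of its branch vertex \<open>s\<close>. Both the length and the distance are multiples of
  3.\<close>

lemma hops_cycle:
  assumes "geodesic u P" "geodesic u Q" "adj (last P) (last Q)"
    "last P \<notin> set Q" "last Q \<notin> set P"
  shows "3 dvd hops u (last P) + hops u (last Q) + 1"
proof -
  obtain s C where *: "branch s" "linked s C s"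
      "length C + 2 * hops u s = hops u (last P) + hops u (last Q) + 2"
    using geodesic_cycle assms branch_u by blast
  have "3 dvd length C - 1" "C \<noteq> []" using mod3 * by (auto simp: linked_def)
  moreover have "3 dvd hops u s" using hops_branch * by blast
  moreover have "hops u (last P) + hops u (last Q) + 1 = length C - 1 + 2 * hops u s"
    using *(3) \<open>C \<noteq> []\<close> by (cases C) auto
  ultimately show ?thesis by (metis dvd_add dvd_mult)
qed

lemma hops_level_edge:
  assumes "adj x y" "hops u x = hops u y"
  shows "3 dvd 2 * hops u y + 1"
proof -
  have V: "x \<in> V" "y \<in> V" "x \<noteq> y" using assms adj_V adj_V2 adj_irrefl by auto
  obtain P where P: "geodesic u P" "last P = x" using geodesic_exists V centre_V by blast
  obtain Q where Q: "geodesic u Q" "last Q = y" using geodesic_exists V centre_V by blast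
  \<comment> \<open>At equal distance, \<open>x\<close> and \<open>y\<close> would occupy the same
    index of a shortest path.\<close>
  have "y \<notin> set P" using geodesic_nth(2) geodesic_nth(2)[of u P x] P V assms
    by (metis geodesic_def last_in_set)
  moreover have "x \<notin> set Q" using geodesic_nth(2) geodesic_nth(2)[of u Q y] Q V assms
    by (metis geodesic_def last_in_set)
  ultimately show ?thesis using hops_cycle[of P Q] P Q assms by (simp add: mult_2)
qed

text \<open>Extend a shortest path to \<open>z\<close> by \<open>y\<close>. The edge
  \<open>x y\<close> then closes a cycle with a shortest path to \<open>x\<close>, and
  \<open>hops_cycle\<close> gives that 3 divides twice the distance of \<open>y\<close>.\<close>

lemma hops_two_parents:
  assumes "adj x y" "adj z y" "x \<noteq> z" "Suc (hops u x) = hops u y" "Suc (hops u z) = hops u y"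
  shows "3 dvd hops u y"
proof -
  have V: "x \<in> V" "z \<in> V" using assms adj_V by auto
  obtain P where P: "geodesic u P" "last P = x" using geodesic_exists V centre_V by blast
  obtain Q where Q: "geodesic u Q" "last Q = z" using geodesic_exists V centre_V by blast
  have len: "length P = hops u y" "length Q = hops u y"
    using geodesic_length P Q assms by auto
  have Qy: "geodesic u (Q @ [y])" using geodesic_snoc Q len assms by simp
  have "y \<notin> set P" using geodesic_nth(1)[OF P(1), of y] len by auto
  moreover have "x \<notin> set Q" using geodesic_nth(2) Q assms
    by (metis Suc_inject geodesic_def last_in_set)
  ultimately have "3 dvd hops u x + hops u y + 1"
    using hops_cycle[of P "Q @ [y]"] P Qy assms adj_irrefl by auto
  moreover have "hops u x + hops u y + 1 = 2 * hops u y" using assms by simp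
  ultimately show ?thesis by presburger
qed

text \<open>At a branch vertex \<open>y\<close> the distance is a multiple of 3, which no
  neighbour's distance is. Any other \<open>y\<close> has only the neighbours \<open>x\<close> and
  \<open>z\<close>, so one of them is its predecessor on a shortest path and the residue lemma
  applies.\<close>

lemma valid_hops: "valid {v. \<not> 3 dvd hops u v}"
  unfolding valid_def
proof (intro allI impI)
  fix x y z
  assume path: "adj x y" "adj y z" "x \<noteq> z"
  have path': "adj y x" "adj z y" using path adj_sym by auto
  have bounds: "hops u x \<le> Suc (hops u y)" "hops u y \<le> Suc (hops u x)"
    "hops u z \<le> Suc (hops u y)" "hops u y \<le> Suc (hops u z)"
    using hops_adj centre_V path path' by auto
  have level: "hops u x \<noteq> hops u y \<or> 3 dvd 2 * hops u y + 1"
    "hops u z \<noteq> hops u y \<or> 3 dvd 2 * hops u y + 1"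
    using hops_level_edge path path' by auto
  have parents: "Suc (hops u x) \<noteq> hops u y \<or> Suc (hops u z) \<noteq> hops u y \<or> 3 dvd hops u y"
    using hops_two_parents path path' by blast
  have "(\<not> 3 dvd hops u y) \<longleftrightarrow> (\<not> 3 dvd hops u x) \<noteq> (\<not> 3 dvd hops u z)"
  proof (cases "branch y")
    case True
    then have "3 dvd hops u y" by (rule hops_branch)
    then have "\<not> 3 dvd hops u x" "\<not> 3 dvd hops u z"
      using residue_branch bounds level by blast+
    then show ?thesis using \<open>3 dvd hops u y\<close> by simp
  next
    case False
    then have "y \<noteq> u" using branch_u by blast
    then have "hops u y \<noteq> 0" using hops_eq_0 centre_V path adj_V2 by blast
    then obtain n where n: "hops u y = Suc n" by (metis not0_implies_Suc)
    then obtain w where w: "adj w y" "hops u w = n"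
      using hops_pred centre_V path adj_V2 by metis
    then have "w = x \<or> w = z"
      using False path path' adj_sym unfolding branch_def by metis
    then have "Suc (hops u x) = hops u y \<or> Suc (hops u z) = hops u y"
      using n w by auto
    then show ?thesis
      using residue_two_neighbours[of "hops u y" "hops u x" "hops u z"]
        residue_two_neighbours[of "hops u y" "hops u z" "hops u x"] bounds level parents
      by argo
  qed
  then show "y \<in> {v. \<not> 3 dvd hops u v} \<longleftrightarrow>
      (x \<in> {v. \<not> 3 dvd hops u v}) \<noteq> (z \<in> {v. \<not> 3 dvd hops u v})"
    by simp
qed

text \<open>The single pegs \<open>{a}\<close> and \<open>{u}\<close> have different invariant
  parities, so no position with one hole can reach both.\<close>

lemma not_doubly_free: "\<exists>h\<in>V. \<exists>v\<in>V. \<not> eqv (V - {h}) {v}"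
proof -
  let ?L = "{v. \<not> 3 dvd hops u v}"
  obtain a where a: "adj u a" using branch_u by (auto simp: branch_def)
  have V: "a \<in> V" "a \<noteq> u" using a adj_V2 adj_irrefl by auto
  have "hops u a \<le> 1" using hops_adj[OF centre_V a] by simp
  moreover have "hops u a \<noteq> 0" using hops_eq_0 centre_V V by blast
  ultimately have "hops u a = 1" by simp
  then have "par ?L {a}" "\<not> par ?L {u}" by auto
  moreover have "par ?L {v} = par ?L (V - {u})" if "eqv (V - {u}) {v}" for v
    using par_eqv[OF valid_hops that] by blast
  ultimately show ?thesis using V centre_V by metis
qed

end

section \<open>Solvability\<close>

text \<open>The live configuration reached from \<open>V - {h}\<close> has the parity of
  \<open>{a}\<close> or that of \<open>{a, d}\<close>, and the latter jumps to
  \<open>{u}\<close>.\<close>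

lemma free:
  assumes "branch u" "adj u a'" "adj a' d'" "d' \<noteq> u" "h \<in> V"
  shows "\<exists>v\<in>V. eqv (V - {h}) {v}"
proof -
  obtain a b c d L where *: "adj u a" "adj u b" "adj u c" "adj a d" "d \<noteq> u"
      "a \<noteq> b" "b \<noteq> c" "a \<noteq> c" and L: "controlled {a, b, c} V L" "{a, b, c, d} \<subseteq> L" "u \<notin> L"
    using controlled_exists assms(1-4) by blast
  have ne: "a \<noteq> d" "a \<noteq> u" using * adj_irrefl by auto
  obtain Q where Q: "live {a, b, c} Q" "eqv (V - {h}) Q"
    using hole_live * assms(5) by blast
  have V: "u \<in> V" "a \<in> V" "d \<in> V" using * adj_V adj_V2 by auto
  have QV: "Q \<subseteq> V" using eqv_subset Q by blast
  have ctlD: "eqv Q R" if "R \<subseteq> V" "live {a, b, c} R" "par L Q = par L R" for R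
    using L(1) that QV Q unfolding controlled_def by blast
  show ?thesis
  proof (cases "par L Q")
    case True
    then have "eqv Q {a}"
      by (intro ctlD liveI[of a _ b]) (use L * V in auto)
    then show ?thesis using V Q eqv_trans by blast
  next
    case False
    have "live {a, b, c} {a, d}" using * by (auto simp: live_def)
    then have "eqv Q {a, d}"
      by (intro ctlD) (use L V ne False in auto)
    also have "eqv {a, d} {u}"
      by (rule eqv_sym, rule eqv_flip[of u a d]) (use * ne in auto)
    finally show ?thesis using V Q eqv_trans by blast
  qed
qed

text \<open>By \<open>controlled_dichotomy\<close> it suffices that \<open>L\<close> is not valid.
  If it were, the length of \<open>p\<close> would put \<open>t\<close> into \<open>L\<close> by
  \<open>valid_pattern\<close>, while a branch vertex lies outside.\<close>

lemma doubly_free: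
  assumes "branch s" "adj s a'" "adj a' d'" "d' \<noteq> s"
    and t: "branch t" "linked s p t" "\<not> 3 dvd length p - 1" and "h \<in> V" "v \<in> V"
  shows "eqv (V - {h}) {v}"
proof -
  obtain a b c d L where *: "adj s a" "adj s b" "adj s c" "adj a d" "d \<noteq> s"
      "a \<noteq> b" "b \<noteq> c" "a \<noteq> c" and L: "controlled {a, b, c} V L" "{a, b, c, d} \<subseteq> L" "s \<notin> L"
    using controlled_exists assms(1-4) by blast
  obtain Q where Q: "live {a, b, c} Q" "eqv (V - {h}) Q"
    using hole_live * assms by blast
  obtain R where R: "live {a, b, c} R" "eqv {v} R"
    using single_live * assms by blast
  have QV: "Q \<subseteq> V" "R \<subseteq> V" using eqv_subset[OF Q(2)] eqv_subset[OF R(2)] assms by auto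
  have abc: "{a, b, c} \<subseteq> V" using * adj_V2 by auto
  have "\<not> valid L"
  proof
    assume vL: "valid L"
    \<comment> \<open>Since \<open>s\<close> is not in \<open>L\<close>, all its neighbours agree
      with \<open>a\<close>.\<close>
    have nbr: "x \<in> L" if "adj s x" for x
    proof (cases "x = a")
      case False
      have "adj x s" using that adj_sym by blast
      then have "s \<in> L \<longleftrightarrow> (x \<in> L) \<noteq> (a \<in> L)" using validD[OF vL] * False by blast
      then show ?thesis using L by auto
    qed (use L in auto)
    have p: "p \<noteq> []" "last p = t" using t by (auto simp: linked_def)
    have "p ! (length p - 1) \<in> L \<longleftrightarrow> \<not> 3 dvd length p - 1"
      by (rule valid_pattern[OF vL t(2) L(3) nbr]) (use p in auto)
    moreover have "t \<notin> L" using valid_branch vL t by blast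
    ultimately show False using t p by (simp add: last_conv_nth)
  qed
  then have "eqv Q R" using controlled_dichotomy L(1) abc * Q R QV by blast
  then show ?thesis using Q R eqv_trans eqv_sym by blast
qed

text \<open>Without a path of two edges starting at \<open>u\<close>, no edge leaves the closed
  neighbourhood of \<open>u\<close> or joins two neighbours; connectedness leaves only a star
  centred at \<open>u\<close>.\<close>

lemma star_or_edge:
  assumes "u \<in> V"
  obtains a d where "adj u a" "adj a d" "d \<noteq> u"
  | "V = insert u {x. adj u x}" "\<And>x y. adj x y \<longleftrightarrow> (x = u \<and> adj u y) \<or> (y = u \<and> adj u x)"
proof (cases "\<exists>a d. adj u a \<and> adj a d \<and> d \<noteq> u")
  case True
  then show ?thesis using that(1) by blast
next
  case False
  then have no: "d = u" if "adj u a" "adj a d" for a d using that by blast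
  let ?S = "insert u {x. adj u x}"
  have VS: "V = ?S"
  proof (rule ccontr)
    assume "V \<noteq> ?S"
    moreover have "?S \<subseteq> V" using assms adj_V2 by auto
    ultimately obtain v y where vy: "v \<in> V" "v \<notin> ?S" "y \<in> ?S" "adj v y"
      using boundary_edge[of ?S u] by blast
    then have "adj y v" using adj_sym by blast
    then show False using vy(2,3) no[of y v] by auto
  qed
  moreover have "adj x y \<longleftrightarrow> (x = u \<and> adj u y) \<or> (y = u \<and> adj u x)" for x y
    using no[of x y] adj_V[of x y] VS adj_sym by blast
  ultimately show ?thesis using that(2) by blast
qed

lemma branch_iff_card: "branch v \<longleftrightarrow> 3 \<le> card {w. adj v w}"
proof
  have fin: "finite {w. adj v w}"
    by (rule finite_subset[OF _ finite_V]) (use adj_V2 in blast)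
  assume "branch v"
  then obtain a b c where *: "adj v a" "adj v b" "adj v c" "a \<noteq> b" "b \<noteq> c" "a \<noteq> c"
    by (auto simp: branch_def)
  then have "card {a, b, c} \<le> card {w. adj v w}" by (intro card_mono fin) auto
  then show "3 \<le> card {w. adj v w}" using * by simp
next
  assume "3 \<le> card {w. adj v w}"
  then obtain T where "T \<subseteq> {w. adj v w}" "card T = 3" by (metis obtain_subset_with_card_n)
  then show "branch v" unfolding branch_def by (auto simp: card_3_iff)
qed

end

section \<open>Translation to the graph library\<close>

lemma vwalk_iff_successively:
  assumes "pair_wf_digraph G"
  shows "vwalk p (with_proj G) \<longleftrightarrow>
    p \<noteq> [] \<and> hd p \<in> pverts G \<and> successively (\<lambda>x y. (x, y) \<in> parcs G) p"
proof (induction p rule: induct_list012)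
  case (3 x y zs)
  interpret pair_wf_digraph G by fact
  show ?case using 3(2) in_arcsD1 in_arcsD2 by (auto simp: vwalk_def)
qed (auto simp: vwalk_def)

theorem theorem2:
  fixes G :: "'a pair_pre_digraph" and n :: nat
  assumes "pair_graph G"
    and "connected (with_proj G)"
    and "card (pverts G) = n"
    and "\<not> K\<^bsub>1,n - 1\<^esub> (with_proj G)"
    and "\<exists>v \<in> pverts G. 3 \<le> degree G v"
  shows "freely_solvable G \<and>
    (doubly_freely_solvable G \<longleftrightarrow>
      (\<exists>u \<in> pverts G. \<exists>v \<in> pverts G. 3 \<le> degree G u \<and> 3 \<le> degree G v \<and>
        (\<exists>p. path_joining G u p v \<and> \<not> 3 dvd vwalk_length p)))"
proof -
  interpret pair_graph G by fact
  let ?V = "pverts G" and ?adj = "\<lambda>x y. (x, y) \<in> parcs G"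
  have sym: "(y, x) \<in> parcs G" if "(x, y) \<in> parcs G" for x y
    using pair_sym_arcs that by (auto simp: symmetric_def dest: symD)
  interpret solitaire ?V ?adj
  proof
    fix x y assume V: "x \<in> ?V" "y \<in> ?V"
    \<comment> \<open>\<open>connected\<close> means strong connectedness of the symmetric closure,
      which here adds no arcs.\<close>
    have "parcs (mk_symmetric (with_proj G)) = parcs G"
      using sym by (force simp: mk_symmetric_def)
    then have "(x, y) \<in> rtrancl_on ?V (parcs G)"
      using assms(2) V by (simp add: connected_def strongly_connected_def reachable_def mk_symmetric_def)
    then have "(x, y) \<in> (parcs G)\<^sup>*" by (rule rtrancl_on_rtranclI)
    then show "?adj\<^sup>*\<^sup>* x y" by (simp add: rtrancl_def)
  qed (use pair_finite_verts sym in_arcsD1 pair_no_loops in fastforce)+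
  have moves: "(\<lambda>P Q. jump G P Q \<or> unjump G P Q) = move"
  proof (intro ext iffI)
    fix P Q assume "jump G P Q \<or> unjump G P Q"
    then show "move P Q"
    proof
      assume "jump G P Q"
      then obtain x y z where *: "?adj x y" "?adj y z" "x \<in> P" "y \<in> P" "z \<notin> P" "x \<noteq> z"
          "Q = insert z (P - {x, y})"
        by (auto simp: jump_def vpath_def vwalk_def)
      then have "Q = flip {x, y, z} P" by auto
      then show ?thesis using * moveI by blast
    next
      assume "unjump G P Q"
      then obtain x y z where *: "?adj x y" "?adj y z" "x \<notin> P" "y \<notin> P" "z \<in> P"
          "Q = P - {z} \<union> {x, y}"
        by (auto simp: unjump_def vpath_def vwalk_def)
      \<comment> \<open>The peg of an unjump sits on \<open>z\<close>, so the corresponding move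
        runs along \<open>z y x\<close>.\<close>
      then have "Q = flip {z, y, x} P" by auto
      then show ?thesis using * moveI sym by blast
    qed
  next
    fix P Q assume "move P Q"
    then obtain x y z where *: "?adj x y" "?adj y z" "x \<in> P" "z \<notin> P" "Q = flip {x, y, z} P"
      by (auto simp: move_def)
    have ne: "x \<noteq> y" "y \<noteq> z" "x \<noteq> z" using * adj_irrefl by auto
    have paths: "vpath [x, y, z] (with_proj G)" "vpath [z, y, x] (with_proj G)"
      using * ne sym in_arcsD1 in_arcsD2 by (auto simp: vpath_def vwalk_def)
    show "jump G P Q \<or> unjump G P Q"
    proof (cases "y \<in> P")
      case True
      have "Q = insert z (P - {x, y})" using * ne True by auto
      then show ?thesis using * True paths unfolding jump_def by blast
    next
      case False
      have "Q = P - {x} \<union> {z, y}" using * ne False by auto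
      then show ?thesis using * False paths unfolding unjump_def by blast
    qed
  qed
  then have produces: "produces G P Q \<longleftrightarrow> eqv P Q" for P Q
    by (simp add: produces_def eqv_def)
  have degree: "3 \<le> degree G v \<longleftrightarrow> branch v" for v
  proof -
    have "{e \<in> parcs G. fst e = v} = Pair v ` {w. ?adj v w}" by auto
    then show ?thesis
      by (simp add: out_degree_def out_arcs_def branch_iff_card card_image inj_on_def)
  qed
  have joining: "path_joining G s p t \<longleftrightarrow> linked s p t" if "s \<in> ?V" for s p t
    using that vwalk_iff_successively[OF pair_wf_digraph_axioms, of p]
    by (auto simp: path_joining_def linked_def vpath_def)
  have nonstar: "\<exists>a d. ?adj u a \<and> ?adj a d \<and> d \<noteq> u" if u: "u \<in> ?V" for u
  proof (rule ccontr)
    assume no: "\<not> ?thesis"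
    let ?N = "{x. ?adj u x}"
    show False
    proof (rule star_or_edge[OF u])
      fix a d
      assume "?adj u a" "?adj a d" "d \<noteq> u"
      then show False using no by blast
    next
      assume star: "?V = insert u ?N"
        "\<And>x y. ?adj x y \<longleftrightarrow> (x = u \<and> ?adj u y) \<or> (y = u \<and> ?adj u x)"
      have N: "u \<notin> ?N" using adj_irrefl by auto
      have "finite ?N" using star(1) finite_V by (metis finite_insert)
      then have "card ?N = n - 1" using star(1) assms(3) N by simp
      moreover have "parcs G = {u} \<times> ?N \<union> ?N \<times> {u}"
      proof (rule set_eqI)
        fix e
        have "e \<in> parcs G \<longleftrightarrow> fst e = u \<and> snd e \<in> ?N \<or> snd e = u \<and> fst e \<in> ?N"
          using star(2)[of "fst e" "snd e"] by (simp only: prod.collapse mem_Collect_eq)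
        then show "e \<in> parcs G \<longleftrightarrow> e \<in> {u} \<times> ?N \<union> ?N \<times> {u}"
          unfolding Un_iff mem_Times_iff singleton_iff by blast
      qed
      ultimately have "K\<^bsub>1,n - 1\<^esub> (with_proj G)"
        unfolding complete_bipartite_digraph_pair_def
        by (intro conjI exI[of _ "{u}"] exI[of _ ?N]) (use star(1) N finite_V in simp_all)
      then show False using assms(4) by blast
    qed
  qed
  obtain u where u: "u \<in> ?V" "branch u" using assms(5) degree by blast
  have "freely_solvable G"
    unfolding freely_solvable_def produces using free[OF u(2)] nonstar[OF u(1)] by blast
  moreover have "doubly_freely_solvable G \<longleftrightarrow>
      (\<exists>s\<in>?V. \<exists>t\<in>?V. branch s \<and> branch t \<and> (\<exists>p. linked s p t \<and> \<not> 3 dvd length p - 1))"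
    (is "_ \<longleftrightarrow> ?path")
  proof
    assume dfs: "doubly_freely_solvable G"
    show ?path
    proof (rule ccontr)
      assume no: "\<not> ?path"
      have "3 dvd length p - 1" if "branch s" "branch t" "linked s p t" for s t p
      proof -
        have "s \<in> ?V" "t \<in> ?V" using that adj_V by (auto simp: branch_def)
        then show ?thesis using no that by blast
      qed
      then show False
        using not_doubly_free[OF u(2)] dfs unfolding doubly_freely_solvable_def produces by blast
    qed
  next
    assume ?path
    then obtain s t p where "s \<in> ?V" "branch s" "branch t" "linked s p t" "\<not> 3 dvd length p - 1"
      by blast
    then show "doubly_freely_solvable G"
      unfolding doubly_freely_solvable_def produces using doubly_free[of s] nonstar[of s] by blast
  qed
  ultimately show ?thesis
    using joining by (simp add: degree)
qed

end
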